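(* $\mathcal{K}_5\neq\mathcal{K}_5^*$; that is, the class $\mathcal{K}_5$ of matroids satisfying the fifth Kinser inequality is not closed under duality.
   Context: All matroids are finite. For a matroid $M$ with rank function $r$ and ground set $E(M)$, and an integer $n\geq 4$, the $n$-th Kinser inequality for a family $X_1,\dots,X_n$ of subsets of $E(M)$ is $$\sum_{i=3}^n r(X_i)+r(X_1\cup X_2)+r(X_1\cup X_3\cup X_n)+\sum_{i=4}^n r(X_2\cup X_{i-1}\cup X_i)\leq r(X_1\cup X_3)+r(X_1\cup X_n)+\sum_{i=3}^n r(X_2\cup X_i)+\sum_{i=4}^n r(X_{i-1}\cup X_i).$$ $\mathcal{K}_n$ is the class of matroids $M$ that satisfy the $n$-th Kinser inequality for all families $X_1,\dots,X_n$ of subsets of $E(M)$, and $\mathcal{K}_n^*=\{M^* \mid M\in\mathcal{K}_n\}$, where $M^*$ is the dual matroid of $M$. *)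

theory Defs
  imports Main "HOL-Library.Infinite_Typeclass"
begin

text \<open>A (finite) matroid is given by its ground set and its family of independent sets.\<close>

locale matroid =
  fixes E :: "'a set" and \<I> :: "'a set set"
  assumes finite_ground: "finite E"
    and indep_subset_ground: "I \<in> \<I> \<Longrightarrow> I \<subseteq> E"
    and empty_indep: "{} \<in> \<I>"
    and indep_subset: "I \<in> \<I> \<Longrightarrow> J \<subseteq> I \<Longrightarrow> J \<in> \<I>"
    and augment: "I \<in> \<I> \<Longrightarrow> J \<in> \<I> \<Longrightarrow> card I < card J \<Longrightarrow> \<exists>x \<in> J - I. insert x I \<in> \<I>"

definition rank :: "'a set set \<Rightarrow> 'a set \<Rightarrow> nat" where
  "rank \<I> X = Max (card ` {I \<in> \<I>. I \<subseteq> X})"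

definition bases :: "'a set set \<Rightarrow> 'a set set" where
  "bases \<I> = {B \<in> \<I>. \<forall>I \<in> \<I>. B \<subseteq> I \<longrightarrow> I = B}"

text \<open>The bases of the dual matroid are the complements of the bases; its independent sets are
  therefore the subsets of such complements.\<close>

definition dual_indep :: "'a set \<Rightarrow> 'a set set \<Rightarrow> 'a set set" where
  "dual_indep E \<I> = {I. \<exists>B \<in> bases \<I>. I \<subseteq> E - B}"

fun dual :: "'a set \<times> 'a set set \<Rightarrow> 'a set \<times> 'a set set" where
  "dual (E, \<I>) = (E, dual_indep E \<I>)"

text \<open>The \<open>n\<close>-th Kinser inequality, meant for \<open>n \<ge> 4\<close>. Only \<open>X 1, \<dots>, X n\<close> occur in it.\<close>

definition kinser_inequality :: "nat \<Rightarrow> ('a set \<Rightarrow> nat) \<Rightarrow> (nat \<Rightarrow> 'a set) \<Rightarrow> bool" where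
  "kinser_inequality n r X \<longleftrightarrow>
     (\<Sum>i=3..n. r (X i)) + r (X 1 \<union> X 2) + r (X 1 \<union> X 3 \<union> X n)
       + (\<Sum>i=4..n. r (X 2 \<union> X (i - 1) \<union> X i))
     \<le> r (X 1 \<union> X 3) + r (X 1 \<union> X n) + (\<Sum>i=3..n. r (X 2 \<union> X i))
       + (\<Sum>i=4..n. r (X (i - 1) \<union> X i))"

text \<open>The classes \<open>\<K>\<^sub>n\<close> and \<open>\<K>\<^sub>n\<^sup>*\<close>, consisting of matroids with ground sets in the type \<open>'a\<close>.
  If \<open>'a\<close> is infinite, every finite matroid has an isomorphic copy with ground set in \<open>'a\<close>.\<close>

definition kinser_class :: "nat \<Rightarrow> ('a set \<times> 'a set set) set" where
  "kinser_class n = {(E, \<I>). matroid E \<I> \<and>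
     (\<forall>X. (\<forall>i \<in> {1..n}. X i \<subseteq> E) \<longrightarrow> kinser_inequality n (rank \<I>) X)}"

definition dual_kinser_class :: "nat \<Rightarrow> ('a set \<times> 'a set set) set" where
  "dual_kinser_class n = dual ` kinser_class n"

end

theory Submission
  imports Defs
begin

text \<open>
  Write \<open>I(A; B | C) = r(A \<union> C) + r(B \<union> C) - r(C) - r(A \<union> B \<union> C)\<close>, which is nonnegative by
  submodularity. In this notation the fifth Kinser inequality reads
  \<open>I(X\<^sub>2; X\<^sub>4) \<le> I(X\<^sub>2; X\<^sub>4 | X\<^sub>3) + I(X\<^sub>2; X\<^sub>4 | X\<^sub>5) + I(X\<^sub>3; X\<^sub>5 | X\<^sub>1) + I(X\<^sub>1; X\<^sub>2)\<close>,
  and for \<open>X\<^sub>1 = {}\<close> it is the Ingleton inequality. (The sets \<open>X\<^sub>1, \<dots>, X\<^sub>5\<close> are called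
  \<open>A, B, C, D, F\<close> below.)

  The matroid that separates the two classes is a sparse paving matroid of rank 5 on ten points: a
  family of 5-sets, any two of which share at most three points, is declared dependent, and these
  sets are its circuit-hyperplanes. Draw a wheel with a two-point hub and four rim vertices, each
  of which is a triple of points; neighbouring triples share one point and opposite triples are
  disjoint. Each of the four spokes (hub and a triple) and of the four rim edges (two neighbouring
  triples) is a set of five points. The complement of a spoke consists of two neighbouring triples
  of a second such wheel with the same hub, and the complement of a rim edge is a spoke of this
  second wheel. So duality exchanges spokes and rim edges. Let all of these 5-sets except one rim
  edge be circuit-hyperplanes. Then the dual is a wheel in which one spoke is missing. This
  dual violates the inequality (\<open>kinser_gap_dual_wheel\<close>): for \<open>X\<^sub>2\<close> take the hub and for
  \<open>X\<^sub>3, X\<^sub>4, X\<^sub>5, X\<^sub>1\<close> the triples in cyclic order, the missing spoke being \<open>X\<^sub>1 \<union> X\<^sub>2\<close>; all terms on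
  the right vanish, but \<open>I(X\<^sub>2; X\<^sub>4) = 1\<close>.

  To see that the wheel with a missing rim edge satisfies the inequality, suppose that it does not.
  If one of the sets \<open>X\<^sub>i \<union> X\<^sub>j\<close> on the large side of the inequality spans one of the sets
  \<open>X\<^sub>i \<union> X\<^sub>j \<union> X\<^sub>l\<close> on the small side, the inequality follows from submodularity and the Ingleton inequality. Otherwise none of
  these sets is spanning, so their ranks are their cardinalities, reduced by one for
  circuit-hyperplanes. Cardinalities themselves satisfy the inequality, and counting leaves very
  little room: \<open>X\<^sub>2 \<union> X\<^sub>4\<close>, \<open>X\<^sub>2 \<union> X\<^sub>3\<close>, \<open>X\<^sub>3 \<union> X\<^sub>4\<close>, \<open>X\<^sub>2 \<union> X\<^sub>5\<close>, \<open>X\<^sub>4 \<union> X\<^sub>5\<close> are all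
  circuit-hyperplanes, \<open>X\<^sub>1 \<union> X\<^sub>2\<close> is not, and all remaining estimates are sharp
  (\<open>tight_if_kinser_gap_negative\<close>). For the wheel, this forces \<open>{X\<^sub>2, X\<^sub>4}\<close> to consist of the hub and
  a rim triple \<open>T\<close> and \<open>X\<^sub>3, X\<^sub>5\<close> to be the two neighbours of \<open>T\<close>. Sharpness then forces \<open>X\<^sub>1 = T\<close>
  and \<open>X\<^sub>2\<close> to be the hub, so that \<open>X\<^sub>1 \<union> X\<^sub>2\<close> is a spoke after all (\<open>wheel_not_tight\<close>). This
  argument with \<open>X\<^sub>1 = {}\<close> also gives the Ingleton inequality that it relies on.
\<close>

section \<open>Conditional information and the fifth Kinser inequality\<close>

definition cond_info :: "('a set \<Rightarrow> nat) \<Rightarrow> 'a set \<Rightarrow> 'a set \<Rightarrow> 'a set \<Rightarrow> int" where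
  "cond_info r A B C = int (r (A \<union> C)) + int (r (B \<union> C)) - int (r C) - int (r (A \<union> B \<union> C))"

text \<open>The right-hand side minus the left-hand side of the fifth Kinser inequality for
  \<open>X\<^sub>1, \<dots>, X\<^sub>5 = A, B, C, D, F\<close>.\<close>

definition kinser_gap :: "('a set \<Rightarrow> nat) \<Rightarrow> 'a set \<Rightarrow> 'a set \<Rightarrow> 'a set \<Rightarrow> 'a set \<Rightarrow> 'a set \<Rightarrow> int" where
  "kinser_gap r A B C D F =
     cond_info r B D C + cond_info r B D F + cond_info r C F A + cond_info r A B {} - cond_info r B D {}"

lemma kinser_inequality_5_iff:
  assumes "r {} = 0"
  shows "kinser_inequality 5 r X \<longleftrightarrow> 0 \<le> kinser_gap r (X 1) (X 2) (X 3) (X 4) (X 5)"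
proof -
  have s3: "{3..5} = {3, 4, 5::nat}" and s4: "{4..5} = {4, 5::nat}" by auto
  show ?thesis
    unfolding kinser_inequality_def kinser_gap_def cond_info_def s3 s4
    using assms by (simp add: Un_ac) linarith
qed

lemma kinser_gap_swap: "kinser_gap r A B F D C = kinser_gap r A B C D F"
  by (simp add: kinser_gap_def cond_info_def Un_ac)

locale polymatroid =
  fixes E :: "'a set" and r :: "'a set \<Rightarrow> nat"
  assumes rank_empty: "r {} = 0"
    and rank_mono: "A \<subseteq> B \<Longrightarrow> B \<subseteq> E \<Longrightarrow> r A \<le> r B"
    and rank_submodular: "A \<subseteq> E \<Longrightarrow> B \<subseteq> E \<Longrightarrow> r (A \<union> B) + r (A \<inter> B) \<le> r A + r B"
begin

lemma cond_info_nonneg: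
  assumes "A \<subseteq> E" "B \<subseteq> E" "C \<subseteq> E"
  shows "0 \<le> cond_info r A B C"
proof -
  have "r ((A \<union> C) \<union> (B \<union> C)) + r ((A \<union> C) \<inter> (B \<union> C)) \<le> r (A \<union> C) + r (B \<union> C)"
    using assms by (intro rank_submodular) auto
  moreover have "r C \<le> r ((A \<union> C) \<inter> (B \<union> C))"
    using assms by (intro rank_mono) auto
  moreover have "(A \<union> C) \<union> (B \<union> C) = A \<union> B \<union> C" by auto
  ultimately show ?thesis by (simp add: cond_info_def)
qed

text \<open>The next four lemmas deal with families in which one of the pairs on the large side has the same
  rank as one of the triples on the small side that contain it. In the first two cases submodularity
  suffices. By the symmetry \<open>kinser_gap_swap\<close> they cover all such pairs.\<close>

lemma kinser_gap_nonneg_if_spans_AC: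
  assumes sub: "A \<subseteq> E" "B \<subseteq> E" "C \<subseteq> E" "D \<subseteq> E" "F \<subseteq> E"
    and "r (A \<union> C \<union> F) \<le> r (A \<union> C)"
  shows "0 \<le> kinser_gap r A B C D F"
proof -
  have "0 \<le> cond_info r B D C" "0 \<le> cond_info r B F D" "0 \<le> cond_info r A B F"
    using sub by (simp_all add: cond_info_nonneg)
  moreover have "r (A \<union> B) \<le> r (A \<union> B \<union> F)"
    using sub by (intro rank_mono) auto
  ultimately show ?thesis using assms(6)
    by (simp add: kinser_gap_def cond_info_def Un_ac rank_empty)
qed

lemma kinser_gap_nonneg_if_spans_CD:
  assumes sub: "A \<subseteq> E" "B \<subseteq> E" "C \<subseteq> E" "D \<subseteq> E" "F \<subseteq> E"
    and "r (B \<union> C \<union> D) \<le> r (C \<union> D)"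
  shows "0 \<le> kinser_gap r A B C D F"
proof -
  have "0 \<le> cond_info r A B F" "0 \<le> cond_info r B F D" "0 \<le> cond_info r C F (A \<union> B)"
    "0 \<le> cond_info r A B C"
    using sub by (simp_all add: cond_info_nonneg)
  moreover have "r (A \<union> C \<union> F) \<le> r (A \<union> B \<union> C \<union> F)"
    using sub by (intro rank_mono) auto
  ultimately show ?thesis using assms(6)
    by (simp add: kinser_gap_def cond_info_def Un_ac rank_empty)
qed

text \<open>The assumed Ingleton inequality bounds \<open>I(C; F | A) + I(A; B)\<close>, the only part of the gap that
  involves \<open>A\<close>, from below by \<open>I(C; F) - I(C; F | B)\<close>. What remains is a statement about
  \<open>B, C, D, F\<close> alone. The next lemma uses the Ingleton inequality for \<open>D, F\<close> in the same role, after
  submodularity has traded \<open>C\<close> for \<open>D\<close>.\<close>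

lemma kinser_gap_nonneg_if_spans_BD:
  assumes sub: "A \<subseteq> E" "B \<subseteq> E" "C \<subseteq> E" "D \<subseteq> E" "F \<subseteq> E"
    and ingleton: "cond_info r C F {} \<le> cond_info r C F A + cond_info r C F B + cond_info r A B {}"
    and "r (B \<union> C \<union> D) \<le> r (B \<union> D)"
  shows "0 \<le> kinser_gap r A B C D F"
proof -
  have "0 \<le> cond_info r C F D" "0 \<le> cond_info r B D (C \<union> F)"
    using sub by (simp_all add: cond_info_nonneg)
  moreover have "r (B \<union> D \<union> F) \<le> r (B \<union> C \<union> D \<union> F)"
    using sub by (intro rank_mono) auto
  ultimately show ?thesis using assms(6,7)
    by (simp add: kinser_gap_def cond_info_def Un_ac rank_empty)
qed

lemma kinser_gap_nonneg_if_spans_BC: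
  assumes sub: "A \<subseteq> E" "B \<subseteq> E" "C \<subseteq> E" "D \<subseteq> E" "F \<subseteq> E"
    and ingleton: "cond_info r D F {} \<le> cond_info r D F A + cond_info r D F B + cond_info r A B {}"
    and "r (B \<union> C \<union> D) \<le> r (B \<union> C)"
  shows "0 \<le> kinser_gap r A B C D F"
proof -
  have "0 \<le> cond_info r C F (A \<union> D)" "0 \<le> cond_info r A D C"
    using sub by (simp_all add: cond_info_nonneg)
  moreover have "r (A \<union> C \<union> F) \<le> r (A \<union> C \<union> D \<union> F)"
    using sub by (intro rank_mono) auto
  ultimately show ?thesis using assms(6,7)
    by (simp add: kinser_gap_def cond_info_def Un_ac rank_empty)
qed

end

section \<open>The rank function of a matroid\<close>

context matroid
begin

lemma finite_indep: "I \<in> \<I> \<Longrightarrow> finite I"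
  using finite_ground finite_subset indep_subset_ground by blast

lemma finite_indeps: "finite {I \<in> \<I>. I \<subseteq> X}"
  by (rule finite_subset[of _ "Pow E"]) (use finite_ground indep_subset_ground in auto)

lemma card_le_rank: "I \<in> \<I> \<Longrightarrow> I \<subseteq> X \<Longrightarrow> card I \<le> rank \<I> X"
  unfolding rank_def by (rule Max_ge) (use finite_indeps in auto)

lemma rank_attained:
  obtains I where "I \<in> \<I>" "I \<subseteq> X" "card I = rank \<I> X"
proof -
  have "rank \<I> X \<in> card ` {I \<in> \<I>. I \<subseteq> X}"
    unfolding rank_def by (rule Max_in) (use finite_indeps empty_indep in auto)
  then show ?thesis using that by auto
qed

lemma extend_to_rank:
  assumes "I \<in> \<I>" "I \<subseteq> X"
  obtains J where "J \<in> \<I>" "I \<subseteq> J" "J \<subseteq> X" "card J = rank \<I> X"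
proof -
  have "\<exists>J. (J \<in> \<I> \<and> I \<subseteq> J \<and> J \<subseteq> X) \<and> (\<forall>K. K \<in> \<I> \<and> I \<subseteq> K \<and> K \<subseteq> X \<longrightarrow> card K \<le> card J)"
    by (rule ex_has_greatest_nat[of _ I _ "Suc (rank \<I> X)"])
      (use assms card_le_rank in \<open>auto simp: less_Suc_eq_le\<close>)
  then obtain J where J: "J \<in> \<I>" "I \<subseteq> J" "J \<subseteq> X"
    and greatest: "\<And>K. K \<in> \<I> \<Longrightarrow> I \<subseteq> K \<Longrightarrow> K \<subseteq> X \<Longrightarrow> card K \<le> card J"
    by blast
  obtain B where B: "B \<in> \<I>" "B \<subseteq> X" "card B = rank \<I> X" by (rule rank_attained)
  have "\<not> card J < card B"
  proof
    assume "card J < card B"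
    then obtain x where x: "x \<in> B - J" "insert x J \<in> \<I>" using augment J(1) B(1) by blast
    then have "card (insert x J) \<le> card J" using greatest[of "insert x J"] J B by blast
    then show False using x finite_indep[OF J(1)] by auto
  qed
  then show ?thesis using that J B card_le_rank[OF J(1,3)] by simp
qed

text \<open>For submodularity, extend a maximal independent subset of \<open>A \<inter> B\<close> to a maximal independent
  subset \<open>J\<close> of \<open>A \<union> B\<close> and count \<open>J \<inter> A\<close> and \<open>J \<inter> B\<close>.\<close>

lemma polymatroid_rank: "polymatroid E (rank \<I>)"
proof
  show "rank \<I> {} = 0" using rank_attained[of "{}"] by fastforce
  show "rank \<I> A \<le> rank \<I> B" if "A \<subseteq> B" for A B
    by (rule rank_attained[of A]) (metis card_le_rank order_trans that)
  show "rank \<I> (A \<union> B) + rank \<I> (A \<inter> B) \<le> rank \<I> A + rank \<I> B" for A B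
  proof -
    obtain I where I: "I \<in> \<I>" "I \<subseteq> A \<inter> B" "card I = rank \<I> (A \<inter> B)" by (rule rank_attained)
    obtain J where J: "J \<in> \<I>" "I \<subseteq> J" "J \<subseteq> A \<union> B" "card J = rank \<I> (A \<union> B)"
      using extend_to_rank[of I "A \<union> B"] I by blast
    have fin: "finite J" using finite_indep J by blast
    have "J = (J \<inter> A) \<union> (J \<inter> B)" using J by auto
    then have "card J + card ((J \<inter> A) \<inter> (J \<inter> B)) = card (J \<inter> A) + card (J \<inter> B)"
      using card_Un_Int[of "J \<inter> A" "J \<inter> B"] fin by auto
    moreover have "card I \<le> card ((J \<inter> A) \<inter> (J \<inter> B))"
      by (rule card_mono) (use fin I J in auto)
    moreover have "card (J \<inter> A) \<le> rank \<I> A" "card (J \<inter> B) \<le> rank \<I> B"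
      using J by (auto intro!: card_le_rank intro: indep_subset)
    ultimately show ?thesis using I J by linarith
  qed
qed

end

section \<open>Sparse paving matroids and their duals\<close>

definition sp_indep :: "'a set \<Rightarrow> nat \<Rightarrow> 'a set set \<Rightarrow> 'a set set" where
  "sp_indep E k \<C> = {I. I \<subseteq> E \<and> card I \<le> k \<and> I \<notin> \<C>}"

definition sp_rank :: "nat \<Rightarrow> 'a set set \<Rightarrow> 'a set \<Rightarrow> nat" where
  "sp_rank k \<C> X = (if X \<in> \<C> then k - 1 else min (card X) k)"

text \<open>The members of \<open>\<C>\<close> are the circuit-hyperplanes. That any two of them share at most \<open>k - 2\<close> points
  says that no two differ by the exchange of a single point.\<close>

locale sparse_paving =
  fixes E :: "'a set" and k :: nat and \<C> :: "'a set set"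
  assumes finite_E: "finite E"
    and k_pos: "0 < k" and k_less: "k < card E"
    and circuit_subset: "C \<in> \<C> \<Longrightarrow> C \<subseteq> E"
    and card_circuit: "C \<in> \<C> \<Longrightarrow> card C = k"
    and circuits_far_apart: "C \<in> \<C> \<Longrightarrow> D \<in> \<C> \<Longrightarrow> C \<noteq> D \<Longrightarrow> card (C \<inter> D) + 2 \<le> k"
begin

abbreviation r :: "'a set \<Rightarrow> nat" where "r \<equiv> sp_rank k \<C>"

lemma finite_sub: "X \<subseteq> E \<Longrightarrow> finite X"
  using finite_E finite_subset by blast

lemma not_both_circuits:
  assumes "insert x I \<in> \<C>" "insert y I \<in> \<C>" "x \<notin> I" "y \<notin> I"
  shows "x = y"
proof (rule ccontr)
  assume "x \<noteq> y"
  have "finite I" using assms(1) circuit_subset finite_sub by blast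
  then have "card I + 1 = k" using card_circuit[OF assms(1)] assms(3) by simp
  moreover have "insert x I \<inter> insert y I = I" "insert x I \<noteq> insert y I"
    using \<open>x \<noteq> y\<close> assms(3,4) by auto
  ultimately show False using circuits_far_apart[OF assms(1,2)] by simp
qed

text \<open>Two different one-point extensions of a set of size \<open>k - 1\<close> are not both in \<open>\<C>\<close>; hence two points
  in reserve are enough to avoid \<open>\<C>\<close>.\<close>

lemma extend_to_basis:
  assumes "I \<subseteq> X" "X \<subseteq> E" "card I < k" "k < card X"
  obtains B where "I \<subseteq> B" "B \<subseteq> X" "card B = k" "B \<notin> \<C>"
proof -
  have fin: "finite X" "finite I" using assms finite_sub finite_subset by blast+
  have "card (X - I) = card X - card I" using assms fin by (simp add: card_Diff_subset)
  then obtain S where S: "S \<subseteq> X - I" "card S = k - 1 - card I"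
    using obtain_subset_with_card_n[of "k - 1 - card I" "X - I"] assms(3,4) by (metis diff_le_mono diff_le_self
      le_trans less_imp_le_nat)
  let ?J = "I \<union> S"
  have "finite S" using S fin finite_subset by blast
  then have J: "card ?J = k - 1" "?J \<subseteq> X" "finite ?J"
    using S assms fin card_Un_disjoint[of I S] by auto
  have "card (X - ?J) = card X - (k - 1)" using J fin by (simp add: card_Diff_subset)
  then have "2 \<le> card (X - ?J)" using assms k_pos by linarith
  then obtain T where "T \<subseteq> X - ?J" "card T = 2"
    using obtain_subset_with_card_n by metis
  then obtain x y where xy: "x \<noteq> y" "x \<in> X - ?J" "y \<in> X - ?J"
    by (auto simp: card_2_iff)
  then have "insert x ?J \<notin> \<C> \<or> insert y ?J \<notin> \<C>" using not_both_circuits by blast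
  moreover have "card (insert x ?J) = k" "card (insert y ?J) = k" using J xy k_pos by auto
  ultimately show ?thesis using that[of "insert x ?J"] that[of "insert y ?J"] J(2) xy by blast
qed

lemma sp_matroid: "matroid E (sp_indep E k \<C>)"
proof
  show "finite E" by (rule finite_E)
  show "I \<subseteq> E" if "I \<in> sp_indep E k \<C>" for I using that by (simp add: sp_indep_def)
  show "{} \<in> sp_indep E k \<C>" using card_circuit[of "{}"] k_pos by (auto simp: sp_indep_def)
  show "J \<in> sp_indep E k \<C>" if I: "I \<in> sp_indep E k \<C>" "J \<subseteq> I" for I J
  proof -
    have "finite I" using I finite_sub by (simp add: sp_indep_def)
    then have "card J \<le> card I" "card J = card I \<Longrightarrow> J = I"
      using I(2) card_mono card_subset_eq by metis+
    then show ?thesis using I card_circuit[of J] by (auto simp: sp_indep_def)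
  qed
  show "\<exists>x\<in>J - I. insert x I \<in> sp_indep E k \<C>"
    if I: "I \<in> sp_indep E k \<C>" and J: "J \<in> sp_indep E k \<C>" and less: "card I < card J" for I J
  proof -
    have fin: "finite I" "finite J" using I J finite_sub by (auto simp: sp_indep_def)
    obtain x where x: "x \<in> J - I" using less card_mono[OF fin(1), of J] by fastforce
    show ?thesis
    proof (cases "insert x I \<in> \<C>")
      case False
      then have "insert x I \<in> sp_indep E k \<C>" using I J less fin x by (auto simp: sp_indep_def)
      then show ?thesis using x by blast
    next
      case True
      have "insert x I \<noteq> J" using True J by (auto simp: sp_indep_def)
      moreover have "card (insert x I) = card I + 1" using fin x by simp
      ultimately obtain y where y: "y \<in> J - I" "y \<noteq> x"
        using card_seteq[of "insert x I" J] fin less by auto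
      then have "insert y I \<notin> \<C>" using True x not_both_circuits by blast
      then have "insert y I \<in> sp_indep E k \<C>" using I J less fin y by (auto simp: sp_indep_def)
      then show ?thesis using y by blast
    qed
  qed
qed

lemma rank_eq_sp_rank:
  assumes "X \<subseteq> E"
  shows "rank (sp_indep E k \<C>) X = r X"
proof -
  interpret matroid E "sp_indep E k \<C>" by (rule sp_matroid)
  have fin: "finite X" using assms finite_sub by blast
  obtain I where I: "I \<in> sp_indep E k \<C>" "I \<subseteq> X" "card I = rank (sp_indep E k \<C>) X"
    by (rule rank_attained)
  have le: "card I \<le> card X" "card I = card X \<Longrightarrow> I = X" using I(2) fin card_mono card_subset_eq by metis+
  show ?thesis
  proof (cases "X \<in> \<C>")
    case True
    obtain S where S: "S \<subseteq> X" "card S = k - 1"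
      using obtain_subset_with_card_n[of "k - 1" X] card_circuit[OF True] by auto
    have "S \<notin> \<C>" using S card_circuit[of S] k_pos by auto
    then have "k - 1 \<le> rank (sp_indep E k \<C>) X"
      using card_le_rank[of S X] S assms by (auto simp: sp_indep_def)
    moreover have "card I \<noteq> k" using le True I card_circuit[OF True] by (auto simp: sp_indep_def)
    ultimately show ?thesis using I le True card_circuit[OF True] by (simp add: sp_rank_def)
  next
    case False
    have "min (card X) k \<le> rank (sp_indep E k \<C>) X"
    proof (cases "card X \<le> k")
      case True
      then show ?thesis using card_le_rank[of X X] assms False by (simp add: sp_indep_def)
    next
      case gt: False
      obtain B where B: "{} \<subseteq> B" "B \<subseteq> X" "card B = k" "B \<notin> \<C>"
        using extend_to_basis[of "{}" X] gt assms k_pos by auto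
      then have "B \<in> sp_indep E k \<C>" using assms by (auto simp: sp_indep_def)
      then show ?thesis using card_le_rank[of B X] B by simp
    qed
    moreover have "card I \<le> k" using I by (simp add: sp_indep_def)
    ultimately show ?thesis using I le False by (simp add: sp_rank_def)
  qed
qed

lemma sp_polymatroid: "polymatroid E r"
proof -
  have P: "polymatroid E (rank (sp_indep E k \<C>))" by (rule matroid.polymatroid_rank[OF sp_matroid])
  show ?thesis
  proof
    show "r {} = 0" using polymatroid.rank_empty[OF P] rank_eq_sp_rank[of "{}"] by simp
    show "r A \<le> r B" if "A \<subseteq> B" "B \<subseteq> E" for A B
      using polymatroid.rank_mono[OF P that] that rank_eq_sp_rank by (metis order_trans)
    show "r (A \<union> B) + r (A \<inter> B) \<le> r A + r B" if "A \<subseteq> E" "B \<subseteq> E" for A B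
    proof -
      have "A \<union> B \<subseteq> E" "A \<inter> B \<subseteq> E" using that by auto
      then show ?thesis using polymatroid.rank_submodular[OF P that] that by (simp add: rank_eq_sp_rank)
    qed
  qed
qed

sublocale polymatroid E r by (rule sp_polymatroid)

lemma bases_sp_indep: "bases (sp_indep E k \<C>) = {B. B \<subseteq> E \<and> card B = k \<and> B \<notin> \<C>}"
proof (intro set_eqI iffI)
  fix B assume B: "B \<in> bases (sp_indep E k \<C>)"
  then have I: "B \<subseteq> E" "card B \<le> k" "B \<notin> \<C>" and max: "\<And>I. I \<in> sp_indep E k \<C> \<Longrightarrow> B \<subseteq> I \<Longrightarrow> I = B"
    by (auto simp: bases_def sp_indep_def)
  have "card B = k"
  proof (rule ccontr)
    assume "card B \<noteq> k"
    then obtain B' where "B \<subseteq> B'" "B' \<subseteq> E" "card B' = k" "B' \<notin> \<C>"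
      using extend_to_basis[of B E] I k_less by auto
    then show False using max[of B'] \<open>card B \<noteq> k\<close> by (auto simp: sp_indep_def)
  qed
  then show "B \<in> {B. B \<subseteq> E \<and> card B = k \<and> B \<notin> \<C>}" using I by simp
next
  fix B assume "B \<in> {B. B \<subseteq> E \<and> card B = k \<and> B \<notin> \<C>}"
  moreover have "I = B" if "I \<subseteq> E" "card I \<le> k" "B \<subseteq> I" "card B = k" for I
    using card_seteq[of I B] that finite_sub by auto
  ultimately show "B \<in> bases (sp_indep E k \<C>)"
    by (auto simp: bases_def sp_indep_def)
qed

text \<open>Complementation preserves the size of the symmetric difference, so complements of
  circuit-hyperplanes are as far apart as the circuit-hyperplanes themselves.\<close>

lemma dual_sparse_paving: "sparse_paving E (card E - k) ((-) E ` \<C>)"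
proof
  show "finite E" by (rule finite_E)
  show "0 < card E - k" "card E - k < card E" using k_pos k_less by auto
  show "C \<subseteq> E" if "C \<in> (-) E ` \<C>" for C using that by auto
  show "card C = card E - k" if mem: "C \<in> (-) E ` \<C>" for C
  proof -
    obtain C' where "C' \<in> \<C>" "C = E - C'" using mem by blast
    then show ?thesis
      using circuit_subset[of C'] card_circuit[of C'] finite_sub[of C'] by (simp add: card_Diff_subset)
  qed
  show "card (C \<inter> D) + 2 \<le> card E - k"
    if CD: "C \<in> (-) E ` \<C>" "D \<in> (-) E ` \<C>" "C \<noteq> D" for C D
  proof -
    obtain C' D' where C': "C' \<in> \<C>" "C = E - C'" and D': "D' \<in> \<C>" "D = E - D'" using CD by auto
    have sub: "C' \<subseteq> E" "D' \<subseteq> E" "finite C'" "finite D'" using C' D' circuit_subset finite_sub by auto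
    have "card (C' \<inter> D') + 2 \<le> k" using circuits_far_apart[of C' D'] C' D' CD by auto
    moreover have "card (C' \<union> D') + card (C' \<inter> D') = k + k"
      using card_Un_Int[of C' D'] sub C' D' card_circuit by simp
    moreover have "C \<inter> D = E - (C' \<union> D')" using C' D' by auto
    then have "card (C \<inter> D) = card E - card (C' \<union> D')" using sub by (simp add: card_Diff_subset)
    moreover have "card (C' \<union> D') \<le> card E" using sub finite_E by (intro card_mono) auto
    ultimately show ?thesis using k_less by linarith
  qed
qed

lemma dual_sp_indep:
  "dual_indep E (sp_indep E k \<C>) = sp_indep E (card E - k) ((-) E ` \<C>)"
proof -
  interpret D: sparse_paving E "card E - k" "(-) E ` \<C>" by (rule dual_sparse_paving)
  interpret DM: matroid E "sp_indep E (card E - k) ((-) E ` \<C>)" by (rule D.sp_matroid)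
  have co: "E - B \<in> bases (sp_indep E k \<C>) \<longleftrightarrow>
      B \<in> bases (sp_indep E (card E - k) ((-) E ` \<C>))" if "B \<subseteq> E" for B
  proof -
    have "card (E - B) = card E - card B" "card B \<le> card E"
      using that finite_E finite_sub by (simp_all add: card_Diff_subset card_mono)
    then have "card (E - B) = k \<longleftrightarrow> card B = card E - k" using k_less by linarith
    moreover have "E - B \<in> \<C> \<longleftrightarrow> B \<in> (-) E ` \<C>"
    proof
      assume "E - B \<in> \<C>"
      then have "E - (E - B) \<in> (-) E ` \<C>" by (rule imageI)
      then show "B \<in> (-) E ` \<C>" using that by (simp add: double_diff)
    next
      assume "B \<in> (-) E ` \<C>"
      then obtain C where "C \<in> \<C>" "B = E - C" by blast
      then show "E - B \<in> \<C>" using circuit_subset by (simp add: double_diff)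
    qed
    ultimately show ?thesis using that by (simp add: bases_sp_indep D.bases_sp_indep)
  qed
  show ?thesis
  proof (intro set_eqI iffI)
    fix I assume "I \<in> dual_indep E (sp_indep E k \<C>)"
    then obtain B where B: "B \<in> bases (sp_indep E k \<C>)" "I \<subseteq> E - B" unfolding dual_indep_def by blast
    then have "B \<subseteq> E" by (simp add: bases_sp_indep)
    then have "E - B \<in> bases (sp_indep E (card E - k) ((-) E ` \<C>))"
      using co[of "E - B"] B by (simp add: double_diff)
    then show "I \<in> sp_indep E (card E - k) ((-) E ` \<C>)"
      using DM.indep_subset[of "E - B" I] B(2) by (simp add: bases_def)
  next
    fix I assume I: "I \<in> sp_indep E (card E - k) ((-) E ` \<C>)"
    obtain B where B: "I \<subseteq> B" "B \<in> bases (sp_indep E (card E - k) ((-) E ` \<C>))"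
    proof (cases "card I = card E - k")
      case True
      then show ?thesis using that[of I] I unfolding D.bases_sp_indep by (auto simp: sp_indep_def)
    next
      case False
      then have "I \<subseteq> E" "card I < card E - k" using I by (auto simp: sp_indep_def)
      then obtain B where "I \<subseteq> B" "B \<subseteq> E" "card B = card E - k" "B \<notin> (-) E ` \<C>"
        using D.extend_to_basis[of I E] D.k_less by blast
      then show ?thesis using that[of B] unfolding D.bases_sp_indep by blast
    qed
    then have "B \<subseteq> E" by (simp add: D.bases_sp_indep)
    then show "I \<in> dual_indep E (sp_indep E k \<C>)"
      using co[of B] B unfolding dual_indep_def by (blast intro: bexI[of _ "E - B"])
  qed
qed

lemma kinser_class_5_iff:
  "(E, sp_indep E k \<C>) \<in> kinser_class 5 \<longleftrightarrow>
    (\<forall>A B C D F. A \<subseteq> E \<and> B \<subseteq> E \<and> C \<subseteq> E \<and> D \<subseteq> E \<and> F \<subseteq> E \<longrightarrow> 0 \<le> kinser_gap r A B C D F)"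
  (is "?L \<longleftrightarrow> ?R")
proof -
  let ?rk = "rank (sp_indep E k \<C>)"
  have gap: "kinser_inequality 5 ?rk X \<longleftrightarrow> 0 \<le> kinser_gap r (X 1) (X 2) (X 3) (X 4) (X 5)"
    if "\<forall>i\<in>{1..5}. X i \<subseteq> E" for X
  proof -
    have "?rk {} = 0" using rank_eq_sp_rank[of "{}"] rank_empty by simp
    moreover have "X 1 \<subseteq> E" "X 2 \<subseteq> E" "X 3 \<subseteq> E" "X 4 \<subseteq> E" "X 5 \<subseteq> E" using that by simp_all
    then have "kinser_gap ?rk (X 1) (X 2) (X 3) (X 4) (X 5) = kinser_gap r (X 1) (X 2) (X 3) (X 4) (X 5)"
      by (simp add: kinser_gap_def cond_info_def rank_eq_sp_rank)
    ultimately show ?thesis by (simp add: kinser_inequality_5_iff)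
  qed
  have class_iff: "?L \<longleftrightarrow> (\<forall>X. (\<forall>i\<in>{1..5}. X i \<subseteq> E) \<longrightarrow> kinser_inequality 5 ?rk X)"
    unfolding kinser_class_def mem_Collect_eq prod.case using sp_matroid by blast
  show ?thesis
  proof
    assume L: ?L
    show ?R
    proof (intro allI impI)
      fix A B C D F
      assume sub: "A \<subseteq> E \<and> B \<subseteq> E \<and> C \<subseteq> E \<and> D \<subseteq> E \<and> F \<subseteq> E"
      define X where "X = (\<lambda>i::nat. if i = 1 then A else if i = 2 then B else if i = 3 then C else if i = 4 then D else F)"
      have X: "X 1 = A" "X 2 = B" "X 3 = C" "X 4 = D" "X 5 = F" by (simp_all add: X_def)
      have "\<forall>i\<in>{1..5}. X i \<subseteq> E" using sub by (simp add: X_def)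
      then show "0 \<le> kinser_gap r A B C D F" using L class_iff gap[of X] unfolding X by blast
    qed
  next
    assume ?R
    then have "kinser_inequality 5 ?rk X" if "\<forall>i\<in>{1..5}. X i \<subseteq> E" for X
    proof -
      have "X 1 \<subseteq> E" "X 2 \<subseteq> E" "X 3 \<subseteq> E" "X 4 \<subseteq> E" "X 5 \<subseteq> E" using that by simp_all
      then show ?thesis unfolding gap[OF that] using \<open>?R\<close> by blast
    qed
    then show ?L using class_iff by blast
  qed
qed

end

section \<open>Violations of the Kinser inequality in sparse paving matroids\<close>

context sparse_paving
begin

lemma rank_le_k: "r X \<le> k"
  by (simp add: sp_rank_def)

lemma rank_circuit: "C \<in> \<C> \<Longrightarrow> r C = k - 1"
  by (simp add: sp_rank_def)

lemma rank_nonspanning: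
  assumes "r X < k"
  shows "int (r X) = int (card X) - of_bool (X \<in> \<C>)"
  using assms k_pos card_circuit[of X] by (auto simp: sp_rank_def of_nat_diff split: if_splits)

text \<open>A nonspanning set that contains a circuit-hyperplane is equal to it. So if \<open>A\<close> were a
  circuit-hyperplane, both nonspanning sets \<open>A \<union> B\<close> and \<open>A \<union> C\<close> would be equal to \<open>A\<close>.\<close>

lemma not_circuit_if_proper_pairs:
  assumes sub: "A \<subseteq> E" "B \<subseteq> E" "C \<subseteq> E"
    and less: "r (A \<union> B) < r (A \<union> B \<union> C)" "r (A \<union> C) < r (A \<union> B \<union> C)"
  shows "A \<notin> \<C>"
proof
  assume A: "A \<in> \<C>"
  have "r (A \<union> B) < k" "r (A \<union> C) < k" using less rank_le_k[of "A \<union> B \<union> C"] by linarith+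
  then have "int (card (A \<union> B)) \<le> int k" "int (card (A \<union> C)) \<le> int k"
    using rank_nonspanning[of "A \<union> B"] rank_nonspanning[of "A \<union> C"]
    by (auto simp: of_bool_def split: if_splits)
  moreover have "finite (A \<union> B)" "finite (A \<union> C)" using sub finite_sub by auto
  ultimately have "A = A \<union> B" "A = A \<union> C"
    using card_seteq[of "A \<union> B" A] card_seteq[of "A \<union> C" A] card_circuit[OF A] by auto
  then have "A \<union> B \<union> C = A \<union> B" by blast
  then show False using less by simp
qed

lemma card_Un_circuits:
  assumes "C \<in> \<C>" "D \<in> \<C>" "C \<noteq> D"
  shows "k + 2 \<le> card (C \<union> D)"
  using circuits_far_apart[OF assms] card_Un_Int[of C D] assms(1,2)
    circuit_subset card_circuit finite_sub by fastforce

text \<open>This is the basic count. All ranks that occur, except that of \<open>A \<union> B \<union> C\<close>, are cardinalities up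
  to the correction for circuit-hyperplanes. By the second part these corrections are made up for by
  the nullity of \<open>A \<union> B \<union> C\<close>: this set properly contains both pairs, and if both are
  circuit-hyperplanes, then it has at least \<open>k + 2\<close> points.\<close>

lemma cond_info_proper_pairs:
  assumes sub: "A \<subseteq> E" "B \<subseteq> E" "C \<subseteq> E"
    and less: "r (A \<union> C) < r (A \<union> B \<union> C)" "r (B \<union> C) < r (A \<union> B \<union> C)"
  shows "cond_info r A B C = int (card (A \<inter> B - C)) + int (card (A \<union> B \<union> C)) - int (r (A \<union> B \<union> C))
      - of_bool (A \<union> C \<in> \<C>) - of_bool (B \<union> C \<in> \<C>)" (is "_ = ?rhs")
    and "of_bool (A \<union> C \<in> \<C>) + of_bool (B \<union> C \<in> \<C>) \<le> int (card (A \<union> B \<union> C)) - int (r (A \<union> B \<union> C))"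
proof -
  have fin: "finite A" "finite B" "finite C" using sub finite_sub by auto
  have nonspanning: "r (A \<union> C) < k" "r (B \<union> C) < k"
    using less rank_le_k[of "A \<union> B \<union> C"] by linarith+
  have "C \<notin> \<C>"
    using not_circuit_if_proper_pairs[of C A B] sub less by (simp add: Un_ac)
  moreover have "r C < k"
    using nonspanning rank_mono[of C "A \<union> C"] sub by fastforce
  ultimately have rC: "int (r C) = int (card C)" using rank_nonspanning[of C] by simp
  have "(A \<union> C) \<inter> (B \<union> C) = C \<union> (A \<inter> B - C)" "(A \<union> C) \<union> (B \<union> C) = A \<union> B \<union> C" by auto
  then have "card (A \<union> C) + card (B \<union> C) = card (A \<union> B \<union> C) + (card C + card (A \<inter> B - C))"
    using card_Un_Int[of "A \<union> C" "B \<union> C"] card_Un_disjoint[of C "A \<inter> B - C"] fin by auto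
  then show "cond_info r A B C = ?rhs"
    using rC rank_nonspanning[OF nonspanning(1)] rank_nonspanning[OF nonspanning(2)]
    unfolding cond_info_def by linarith
  have ne: "A \<union> C \<noteq> B \<union> C"
  proof
    assume "A \<union> C = B \<union> C"
    then have "A \<union> B \<union> C = A \<union> C" by blast
    then show False using less by simp
  qed
  have psub: "A \<union> C \<subset> A \<union> B \<union> C" "B \<union> C \<subset> A \<union> B \<union> C" using less by auto
  then have lt: "card (A \<union> C) < card (A \<union> B \<union> C)" "card (B \<union> C) < card (A \<union> B \<union> C)"
    using fin by (auto intro!: psubset_card_mono)
  have "(A \<union> C) \<union> (B \<union> C) = A \<union> B \<union> C" by auto
  then have both: "k + 2 \<le> card (A \<union> B \<union> C)" if "A \<union> C \<in> \<C>" "B \<union> C \<in> \<C>"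
    using card_Un_circuits[OF that ne] by simp
  have "r (A \<union> B \<union> C) \<le> card (A \<union> B \<union> C)"
    using card_circuit[of "A \<union> B \<union> C"] by (auto simp: sp_rank_def)
  then show "of_bool (A \<union> C \<in> \<C>) + of_bool (B \<union> C \<in> \<C>) \<le> int (card (A \<union> B \<union> C)) - int (r (A \<union> B \<union> C))"
    using both lt rank_le_k[of "A \<union> B \<union> C"] card_circuit[of "A \<union> C"] card_circuit[of "B \<union> C"]
    by (cases "A \<union> C \<in> \<C>"; cases "B \<union> C \<in> \<C>") auto
qed

text \<open>If \<open>A \<union> B\<close> is a circuit-hyperplane as well, then a second circuit-hyperplane among the three pairs
  already makes \<open>A \<union> B \<union> C\<close> exceed the rank by two. So only all three together can keep
  \<open>I(A; B | C)\<close> down to its cardinality part.\<close>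

lemma excess_triangle:
  assumes sub: "A \<subseteq> E" "B \<subseteq> E" "C \<subseteq> E"
    and AB: "A \<union> B \<in> \<C>"
    and less: "r (A \<union> C) < r (A \<union> B \<union> C)" "r (B \<union> C) < r (A \<union> B \<union> C)" "r (A \<union> B) < r (A \<union> B \<union> C)"
  shows "int (card (A \<inter> B - C)) + of_bool (\<not> (A \<union> C \<in> \<C> \<and> B \<union> C \<in> \<C>)) \<le> cond_info r A B C"
proof -
  have fin: "finite (A \<union> B \<union> C)" using sub finite_sub by auto
  have r: "r (A \<union> B \<union> C) = k"
    using less(3) rank_circuit[OF AB] rank_le_k[of "A \<union> B \<union> C"] by linarith
  have "A \<union> B \<subset> A \<union> B \<union> C" using less by auto
  then have "card (A \<union> B) < card (A \<union> B \<union> C)" using fin by (intro psubset_card_mono)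
  then have gt: "k < card (A \<union> B \<union> C)" using card_circuit[OF AB] by simp
  have one: "k + 2 \<le> card (A \<union> B \<union> C)"
    if "A \<union> C \<in> \<C> \<or> B \<union> C \<in> \<C>"
  proof -
    have "A \<union> C \<noteq> A \<union> B \<or> A \<union> C \<notin> \<C>" "B \<union> C \<noteq> A \<union> B \<or> B \<union> C \<notin> \<C>"
    proof -
      have "A \<union> B \<union> C = A \<union> C" if "A \<union> C = A \<union> B" using that by blast
      then show "A \<union> C \<noteq> A \<union> B \<or> A \<union> C \<notin> \<C>" using less by force
      have "A \<union> B \<union> C = B \<union> C" if "B \<union> C = A \<union> B" using that by blast
      then show "B \<union> C \<noteq> A \<union> B \<or> B \<union> C \<notin> \<C>" using less by force
    qed
    moreover have "A \<union> C \<union> (A \<union> B) = A \<union> B \<union> C" "B \<union> C \<union> (A \<union> B) = A \<union> B \<union> C" by auto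
    ultimately show ?thesis using that AB card_Un_circuits by metis
  qed
  show ?thesis
    using cond_info_proper_pairs(1)[OF sub less(1,2)] r gt one
    by (cases "A \<union> C \<in> \<C>"; cases "B \<union> C \<in> \<C>") auto
qed

lemma cond_info_ge_card:
  assumes "A \<subseteq> E" "B \<subseteq> E" "C \<subseteq> E"
    and "r (A \<union> C) < r (A \<union> B \<union> C)" "r (B \<union> C) < r (A \<union> B \<union> C)"
  shows "int (card (A \<inter> B - C)) \<le> cond_info r A B C"
  using cond_info_proper_pairs[OF assms] by linarith

text \<open>This is the Kinser inequality for the free matroid, where \<open>I(A; B | C)\<close> is the cardinality of
  \<open>A \<inter> B - C\<close>.\<close>

lemma card_gap_nonneg:
  assumes "finite A" "finite B" "finite C" "finite D" "finite F"
  shows "card (B \<inter> D) \<le> card (B \<inter> D - C) + card (B \<inter> D - F) + card (C \<inter> F - A) + card (A \<inter> B)"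
proof -
  have "B \<inter> D \<subseteq> (B \<inter> D - C) \<union> (B \<inter> D - F) \<union> (C \<inter> F - A) \<union> (A \<inter> B)" by auto
  then have "card (B \<inter> D) \<le> card ((B \<inter> D - C) \<union> (B \<inter> D - F) \<union> (C \<inter> F - A) \<union> (A \<inter> B))"
    using assms by (intro card_mono) auto
  also have "\<dots> \<le> card (B \<inter> D - C) + card (B \<inter> D - F) + card (C \<inter> F - A) + card (A \<inter> B)"
    by (intro order_trans[OF card_Un_le] add_mono order_refl)
  finally show ?thesis .
qed

text \<open>The situation in which every estimate of the counting argument is sharp. The two distinctness
  conditions express that the three pairs inside \<open>B, C, D\<close>, and those inside \<open>B, F, D\<close>, are different
  circuit-hyperplanes, and the equation before \<open>A \<union> B \<notin> \<C>\<close> says that the nullity of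
  \<open>A \<union> C \<union> F\<close> exactly makes up for the corrections of \<open>A \<union> C\<close> and \<open>A \<union> F\<close>.\<close>

definition tight_kinser_config :: "'a set \<Rightarrow> 'a set \<Rightarrow> 'a set \<Rightarrow> 'a set \<Rightarrow> 'a set \<Rightarrow> bool" where
  "tight_kinser_config A B C D F \<longleftrightarrow>
     {B \<union> D, B \<union> C, C \<union> D, B \<union> F, F \<union> D} \<subseteq> \<C> \<and>
     distinct [B \<union> D, B \<union> C, C \<union> D] \<and> distinct [B \<union> D, B \<union> F, F \<union> D] \<and>
     r (A \<union> C) < r (A \<union> C \<union> F) \<and> r (A \<union> F) < r (A \<union> C \<union> F) \<and>
     int (card (A \<union> C \<union> F)) - int (r (A \<union> C \<union> F)) = of_bool (A \<union> C \<in> \<C>) + of_bool (A \<union> F \<in> \<C>) \<and>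
     A \<union> B \<notin> \<C> \<and>
     card (B \<inter> D) = card (B \<inter> D - C) + card (B \<inter> D - F) + card (C \<inter> F - A) + card (A \<inter> B)"

text \<open>The term \<open>I(B; D)\<close> exceeds its cardinality part by at most one, and only if \<open>B \<union> D\<close> is a
  circuit-hyperplane. Every other term is at least its cardinality part, and the cardinality parts
  satisfy the inequality. Hence the gap can only be \<open>- 1\<close>, and then no term has any excess.\<close>

lemma tight_if_kinser_gap_negative:
  assumes sub: "A \<subseteq> E" "B \<subseteq> E" "C \<subseteq> E" "D \<subseteq> E" "F \<subseteq> E"
    and ingleton: "cond_info r C F {} \<le> cond_info r C F A + cond_info r C F B + cond_info r A B {}"
      "cond_info r D F {} \<le> cond_info r D F A + cond_info r D F B + cond_info r A B {}"
      "cond_info r D C {} \<le> cond_info r D C A + cond_info r D C B + cond_info r A B {}"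
    and gap: "kinser_gap r A B C D F < 0"
  shows "tight_kinser_config A B C D F"
proof -
  have fin: "finite A" "finite B" "finite C" "finite D" "finite F" using sub finite_sub by auto
  have gap': "kinser_gap r A B F D C < 0" using gap by (simp add: kinser_gap_swap)
  have ing': "cond_info r F C {} \<le> cond_info r F C A + cond_info r F C B + cond_info r A B {}"
    using ingleton(1) by (simp add: cond_info_def Un_ac add_ac)
  have ACF: "r (A \<union> C) < r (A \<union> C \<union> F)" "r (A \<union> F) < r (A \<union> C \<union> F)"
    using kinser_gap_nonneg_if_spans_AC[OF sub] gap
      kinser_gap_nonneg_if_spans_AC[of A B F D C] gap' sub
    by (force simp: Un_ac)+
  have BCD: "r (B \<union> C) < r (B \<union> D \<union> C)" "r (D \<union> C) < r (B \<union> D \<union> C)" "r (B \<union> D) < r (B \<union> D \<union> C)"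
    using kinser_gap_nonneg_if_spans_BC[OF sub ingleton(2)] kinser_gap_nonneg_if_spans_CD[OF sub]
      kinser_gap_nonneg_if_spans_BD[OF sub ingleton(1)] gap
    by (force simp: Un_ac)+
  have BFD: "r (B \<union> F) < r (B \<union> D \<union> F)" "r (D \<union> F) < r (B \<union> D \<union> F)" "r (B \<union> D) < r (B \<union> D \<union> F)"
    using kinser_gap_nonneg_if_spans_BC[OF sub(1,2,5,4,3) ingleton(3)]
      kinser_gap_nonneg_if_spans_CD[OF sub(1,2,5,4,3)]
      kinser_gap_nonneg_if_spans_BD[OF sub(1,2,5,4,3) ing'] gap'
    by (force simp: Un_ac)+
  have notin: "A \<notin> \<C>" "B \<notin> \<C>" "D \<notin> \<C>"
    using not_circuit_if_proper_pairs[of A C F] not_circuit_if_proper_pairs[of B C D]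
      not_circuit_if_proper_pairs[of D C B] sub ACF BCD by (simp_all add: Un_ac)
  have nonsp: "r A < k" "r B < k" "r D < k" "r (B \<union> D) < k"
    using rank_mono[of A "A \<union> C"] rank_mono[of B "B \<union> C"] rank_mono[of D "D \<union> C"]
      sub ACF BCD rank_le_k[of "A \<union> C \<union> F"] rank_le_k[of "B \<union> D \<union> C"] by fastforce+
  then have rank_card: "int (r A) = card A" "int (r B) = card B" "int (r D) = card D"
    using notin rank_nonspanning by auto
  have card_AB: "card (A \<union> B) + card (A \<inter> B) = card A + card B"
    and card_BD: "card (B \<union> D) + card (B \<inter> D) = card B + card D"
    using card_Un_Int fin by metis+
  have info_BD: "cond_info r B D {} = int (card (B \<inter> D)) + of_bool (B \<union> D \<in> \<C>)"
    using rank_nonspanning[OF nonsp(4)] rank_card card_BD by (simp add: cond_info_def rank_empty)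
  have info_AB: "cond_info r A B {} = int (card (A \<inter> B)) + (int (card (A \<union> B)) - int (r (A \<union> B)))"
    using rank_card card_AB by (simp add: cond_info_def rank_empty)
  have le_AB: "int (r (A \<union> B)) + of_bool (A \<union> B \<in> \<C>) \<le> int (card (A \<union> B))"
    using card_circuit[of "A \<union> B"] k_pos by (auto simp: sp_rank_def)
  note card_gap = card_gap_nonneg[OF fin]
  have info_CF: "cond_info r C F A = int (card (C \<inter> F - A)) + int (card (A \<union> C \<union> F)) - int (r (A \<union> C \<union> F))
      - of_bool (A \<union> C \<in> \<C>) - of_bool (A \<union> F \<in> \<C>)"
    and excess_CF: "of_bool (A \<union> C \<in> \<C>) + of_bool (A \<union> F \<in> \<C>) \<le> int (card (A \<union> C \<union> F)) - int (r (A \<union> C \<union> F))"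
    using cond_info_proper_pairs[of C F A] sub ACF by (simp_all add: Un_ac)
  have ge: "int (card (B \<inter> D - C)) \<le> cond_info r B D C" "int (card (B \<inter> D - F)) \<le> cond_info r B D F"
    using cond_info_ge_card[of B D C] cond_info_ge_card[of B D F] sub BCD BFD by simp_all
  have BD: "B \<union> D \<in> \<C>"
  proof (rule ccontr)
    assume "B \<union> D \<notin> \<C>"
    then show False using gap ge info_BD info_AB info_CF excess_CF le_AB card_gap
      unfolding kinser_gap_def by (simp add: of_bool_def split: if_splits)
  qed
  have tC: "int (card (B \<inter> D - C)) + of_bool (\<not> (B \<union> C \<in> \<C> \<and> D \<union> C \<in> \<C>)) \<le> cond_info r B D C"
    and tF: "int (card (B \<inter> D - F)) + of_bool (\<not> (B \<union> F \<in> \<C> \<and> D \<union> F \<in> \<C>)) \<le> cond_info r B D F"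
    using excess_triangle[of B D C] excess_triangle[of B D F] sub BD BCD BFD by simp_all
  have gap1: "cond_info r B D C + cond_info r B D F + cond_info r C F A + cond_info r A B {}
      \<le> int (card (B \<inter> D))"
    using gap info_BD BD unfolding kinser_gap_def by simp
  have nonneg: "0 \<le> (of_bool P :: int)" for P by simp
  have slack: "of_bool (\<not> (B \<union> C \<in> \<C> \<and> D \<union> C \<in> \<C>)) = (0::int)"
      "of_bool (\<not> (B \<union> F \<in> \<C> \<and> D \<union> F \<in> \<C>)) = (0::int)"
      "of_bool (A \<union> B \<in> \<C>) = (0::int)"
    and rest: "int (card (A \<union> C \<union> F)) - int (r (A \<union> C \<union> F)) = of_bool (A \<union> C \<in> \<C>) + of_bool (A \<union> F \<in> \<C>)"
      "card (B \<inter> D) = card (B \<inter> D - C) + card (B \<inter> D - F) + card (C \<inter> F - A) + card (A \<inter> B)"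
    using tC tF gap1 info_AB info_CF excess_CF le_AB card_gap
      nonneg[of "\<not> (B \<union> C \<in> \<C> \<and> D \<union> C \<in> \<C>)"] nonneg[of "\<not> (B \<union> F \<in> \<C> \<and> D \<union> F \<in> \<C>)"]
      nonneg[of "A \<union> B \<in> \<C>"]
    by linarith+
  have circuits: "B \<union> C \<in> \<C>" "D \<union> C \<in> \<C>" "B \<union> F \<in> \<C>" "D \<union> F \<in> \<C>" "A \<union> B \<notin> \<C>"
    using slack by simp_all
  have ne: "B \<union> D \<noteq> B \<union> C" "B \<union> D \<noteq> C \<union> D" "B \<union> C \<noteq> C \<union> D"
    "B \<union> D \<noteq> B \<union> F" "B \<union> D \<noteq> F \<union> D" "B \<union> F \<noteq> F \<union> D"
  proof -
    have "X = Y \<Longrightarrow> X \<union> Y = X" for X Y :: "'a set" by simp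
    moreover have "(B \<union> D) \<union> (B \<union> C) = B \<union> D \<union> C" "(B \<union> D) \<union> (C \<union> D) = B \<union> D \<union> C"
      "(B \<union> C) \<union> (C \<union> D) = B \<union> D \<union> C" "(B \<union> D) \<union> (B \<union> F) = B \<union> D \<union> F"
      "(B \<union> D) \<union> (F \<union> D) = B \<union> D \<union> F" "(B \<union> F) \<union> (F \<union> D) = B \<union> D \<union> F" by auto
    ultimately show "B \<union> D \<noteq> B \<union> C" "B \<union> D \<noteq> C \<union> D" "B \<union> C \<noteq> C \<union> D"
      "B \<union> D \<noteq> B \<union> F" "B \<union> D \<noteq> F \<union> D" "B \<union> F \<noteq> F \<union> D"
      using BCD BFD by (metis less_irrefl)+
  qed
  show ?thesis unfolding tight_kinser_config_def
    using BD circuits rest ne ACF by (simp add: Un_commute[of F D] Un_commute[of C D])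
qed

text \<open>The Ingleton inequalities that the counting argument requires are themselves instances of its
  conclusion for \<open>A = {}\<close>: in that case the required Ingleton inequalities are trivial.\<close>

lemma kinser_gap_nonneg:
  assumes no_tight: "\<And>A B C D F. A \<subseteq> E \<Longrightarrow> B \<subseteq> E \<Longrightarrow> C \<subseteq> E \<Longrightarrow> D \<subseteq> E \<Longrightarrow> F \<subseteq> E
      \<Longrightarrow> \<not> tight_kinser_config A B C D F"
    and sub: "A \<subseteq> E" "B \<subseteq> E" "C \<subseteq> E" "D \<subseteq> E" "F \<subseteq> E"
  shows "0 \<le> kinser_gap r A B C D F"
proof -
  have empty: "cond_info r {} B {} = 0" for B by (simp add: cond_info_def rank_empty)
  have ingleton: "cond_info r B D {} \<le> cond_info r B D C + cond_info r B D F + cond_info r C F {}"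
    if "B \<subseteq> E" "C \<subseteq> E" "D \<subseteq> E" "F \<subseteq> E" for B C D F
  proof -
    have "0 \<le> cond_info r C F B" "0 \<le> cond_info r D F B" "0 \<le> cond_info r D C B"
      using that by (simp_all add: cond_info_nonneg)
    then have "tight_kinser_config {} B C D F" if "kinser_gap r {} B C D F < 0"
      using \<open>B \<subseteq> E\<close> \<open>C \<subseteq> E\<close> \<open>D \<subseteq> E\<close> \<open>F \<subseteq> E\<close> that
      by (intro tight_if_kinser_gap_negative) (simp_all add: empty)
    then have "\<not> kinser_gap r {} B C D F < 0"
      using no_tight[of "{}" B C D F] that by blast
    then show ?thesis by (simp add: kinser_gap_def empty)
  qed
  have "\<not> kinser_gap r A B C D F < 0"
    using tight_if_kinser_gap_negative[OF sub] no_tight[OF sub]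
      ingleton[of C A F B] ingleton[of D A F B] ingleton[of D A C B] sub by blast
  then show ?thesis by simp
qed

end

section \<open>A wheel with a missing rim edge\<close>

definition hub :: "nat set" where
  "hub = {8, 9}"

text \<open>The points 0, 1, 2, 3 are shared by neighbouring triples, the points 4, 5, 6, 7 lie in one triple
  each.\<close>

definition rim :: "nat \<Rightarrow> nat set" where
  "rim i = {i mod 4, Suc i mod 4, i + 4}"

text \<open>All spokes, and all rim edges except \<open>rim 3 \<union> rim 0\<close>.\<close>

definition wheel_circuits :: "nat set set" where
  "wheel_circuits = {hub \<union> rim 0, hub \<union> rim 1, hub \<union> rim 2, hub \<union> rim 3,
     rim 0 \<union> rim 1, rim 1 \<union> rim 2, rim 2 \<union> rim 3}"

lemma rim_eq: "rim 0 = {0, 1, 4}" "rim 1 = {1, 2, 5}" "rim 2 = {2, 3, 6}" "rim 3 = {0, 3, 7}"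
  by code_simp+

lemma wheel_circuits_eq:
  "wheel_circuits = {{0, 1, 4, 8, 9}, {1, 2, 5, 8, 9}, {2, 3, 6, 8, 9}, {0, 3, 7, 8, 9},
     {0, 1, 2, 4, 5}, {1, 2, 3, 5, 6}, {0, 2, 3, 6, 7}}"
  by code_simp

text \<open>What three sets \<open>X \<union> Y\<close>, \<open>X \<union> Z\<close>, \<open>Y \<union> Z\<close> satisfy if they are distinct; in terms of the
  three sets alone it can be checked without knowing \<open>X, Y, Z\<close>.\<close>

definition triangle :: "'a set \<Rightarrow> 'a set \<Rightarrow> 'a set \<Rightarrow> bool" where
  "triangle P Q R \<longleftrightarrow> P \<noteq> Q \<and> P \<noteq> R \<and> Q \<noteq> R \<and> P \<subseteq> Q \<union> R \<and> Q \<subseteq> P \<union> R \<and> R \<subseteq> P \<union> Q"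

text \<open>The paths of length two along the rim that avoid the missing edge, with their direction.\<close>

definition rim_paths :: "(nat set \<times> nat set \<times> nat set) set" where
  "rim_paths = {(rim 0, rim 1, rim 2), (rim 2, rim 1, rim 0), (rim 1, rim 2, rim 3), (rim 3, rim 2, rim 1)}"

lemma rim_paths_eq:
  "rim_paths = {({0, 1, 4}, {1, 2, 5}, {2, 3, 6}), ({2, 3, 6}, {1, 2, 5}, {0, 1, 4}),
     ({1, 2, 5}, {2, 3, 6}, {0, 3, 7}), ({0, 3, 7}, {2, 3, 6}, {1, 2, 5})}"
  unfolding rim_paths_def rim_eq ..

text \<open>Here \<open>BD, BC, CD, BF, FD\<close> stand for the unions of the pairs. The intersection
  \<open>BD \<inter> BC \<inter> BF\<close> bounds \<open>B\<close> from above and \<open>BD \<inter> CD \<inter> FD\<close> bounds \<open>D\<close>, so the last assumption is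
  necessary for \<open>B \<union> D = BD\<close>. The triangles of the wheel consist of a rim edge and the two spokes at
  its ends. Two of them that share a side are equal or have the spoke at the middle of a path as
  common side.\<close>

lemma wheel_triangle_pairs:
  assumes "BD \<in> wheel_circuits" "BC \<in> wheel_circuits" "CD \<in> wheel_circuits"
    "BF \<in> wheel_circuits" "FD \<in> wheel_circuits"
    and "triangle BD BC CD" "triangle BD BF FD"
    and "BD \<subseteq> BD \<inter> BC \<inter> BF \<union> BD \<inter> CD \<inter> FD"
  shows "BC = BF \<and> CD = FD \<and> card (BD \<inter> BC \<inter> BF \<inter> (BD \<inter> CD \<inter> FD)) \<le> 1 \<or>
    (\<exists>(C, T, F) \<in> rim_paths. C = BC \<inter> CD \<and> F = BF \<inter> FD \<and>
      (BD \<inter> BC \<inter> BF = hub \<and> BD \<inter> CD \<inter> FD = T \<or> BD \<inter> BC \<inter> BF = T \<and> BD \<inter> CD \<inter> FD = hub))"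
proof -
  \<comment> \<open>Conditionals rather than implications: their branches are evaluated only when needed.\<close>
  have "\<forall>BD\<in>wheel_circuits. \<forall>BC\<in>wheel_circuits. \<forall>CD\<in>wheel_circuits.
    if triangle BD BC CD
    then \<forall>BF\<in>wheel_circuits. \<forall>FD\<in>wheel_circuits.
      if triangle BD BF FD
      then if BD \<subseteq> BD \<inter> BC \<inter> BF \<union> BD \<inter> CD \<inter> FD
        then BC = BF \<and> CD = FD \<and> card (BD \<inter> BC \<inter> BF \<inter> (BD \<inter> CD \<inter> FD)) \<le> 1 \<or>
          (\<exists>(C, T, F) \<in> rim_paths. C = BC \<inter> CD \<and> F = BF \<inter> FD \<and>
            (BD \<inter> BC \<inter> BF = hub \<and> BD \<inter> CD \<inter> FD = T \<or> BD \<inter> BC \<inter> BF = T \<and> BD \<inter> CD \<inter> FD = hub))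
        else True
      else True
    else True"
    unfolding wheel_circuits_eq rim_paths_eq hub_def by code_simp
  from bspec[OF bspec[OF bspec[OF this assms(1)] assms(2)] assms(3)]
  have "\<forall>BF\<in>wheel_circuits. \<forall>FD\<in>wheel_circuits.
      if triangle BD BF FD
      then if BD \<subseteq> BD \<inter> BC \<inter> BF \<union> BD \<inter> CD \<inter> FD
        then BC = BF \<and> CD = FD \<and> card (BD \<inter> BC \<inter> BF \<inter> (BD \<inter> CD \<inter> FD)) \<le> 1 \<or>
          (\<exists>(C, T, F) \<in> rim_paths. C = BC \<inter> CD \<and> F = BF \<inter> FD \<and>
            (BD \<inter> BC \<inter> BF = hub \<and> BD \<inter> CD \<inter> FD = T \<or> BD \<inter> BC \<inter> BF = T \<and> BD \<inter> CD \<inter> FD = hub))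
        else True
      else True"
    by (simp only: assms(6) if_True)
  from bspec[OF bspec[OF this assms(4)] assms(5)] show ?thesis
    by (simp only: assms(7,8) if_True)
qed

text \<open>In the last statement, \<open>K\<close> and \<open>L\<close> stand for \<open>A \<union> C\<close> and \<open>A \<union> F\<close>; its assumptions hold for the
  set \<open>A\<close> because \<open>K - C \<subseteq> A \<subseteq> K \<inter> L\<close> and \<open>L - F \<subseteq> A \<subseteq> K \<inter> L\<close>, and its conclusion pins down
  \<open>A = T\<close>.\<close>

lemma wheel_rim_paths:
  assumes "(C, T, F) \<in> rim_paths"
  shows "hub \<union> T \<in> wheel_circuits" "hub \<inter> T = {}" "T \<noteq> {}" "card (C \<union> F) = 6"
    and "K \<in> wheel_circuits \<Longrightarrow> \<not> K \<subseteq> C \<union> F"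
    and "K \<in> wheel_circuits \<Longrightarrow> L \<in> wheel_circuits \<Longrightarrow> C \<subseteq> K \<Longrightarrow> F \<subseteq> L \<Longrightarrow> K - C \<subseteq> L \<Longrightarrow> L - F \<subseteq> K
      \<Longrightarrow> card (K \<union> L) = 7 \<Longrightarrow> K \<inter> L = T \<and> T \<subseteq> (K - C) \<union> (L - F)"
proof -
  have "\<forall>(C, T, F) \<in> rim_paths. hub \<union> T \<in> wheel_circuits \<and> hub \<inter> T = {} \<and> T \<noteq> {} \<and> card (C \<union> F) = 6 \<and>
    (\<forall>K\<in>wheel_circuits. \<not> K \<subseteq> C \<union> F) \<and>
    (\<forall>K\<in>wheel_circuits. \<forall>L\<in>wheel_circuits.
      C \<subseteq> K \<and> F \<subseteq> L \<and> K - C \<subseteq> L \<and> L - F \<subseteq> K \<and> card (K \<union> L) = 7 \<longrightarrow>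
      K \<inter> L = T \<and> T \<subseteq> (K - C) \<union> (L - F))"
    unfolding wheel_circuits_eq rim_paths_eq hub_def by code_simp
  note all = bspec[OF this assms, unfolded prod.case]
  show "hub \<union> T \<in> wheel_circuits"
    by (rule conjunct1[OF all])
  note all = conjunct2[OF all]
  show "hub \<inter> T = {}"
    by (rule conjunct1[OF all])
  note all = conjunct2[OF all]
  show "T \<noteq> {}"
    by (rule conjunct1[OF all])
  note all = conjunct2[OF all]
  show "card (C \<union> F) = 6"
    by (rule conjunct1[OF all])
  note no = conjunct1[OF conjunct2[OF all]] and pair = conjunct2[OF conjunct2[OF all]]
  show "K \<in> wheel_circuits \<Longrightarrow> \<not> K \<subseteq> C \<union> F" by (rule bspec[OF no])
  show "K \<in> wheel_circuits \<Longrightarrow> L \<in> wheel_circuits \<Longrightarrow> C \<subseteq> K \<Longrightarrow> F \<subseteq> L \<Longrightarrow> K - C \<subseteq> L \<Longrightarrow> L - F \<subseteq> K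
      \<Longrightarrow> card (K \<union> L) = 7 \<Longrightarrow> K \<inter> L = T \<and> T \<subseteq> (K - C) \<union> (L - F)"
    by (rule mp[OF bspec[OF bspec[OF pair]]]) (assumption | intro conjI)+
qed

lemma sparse_paving_wheel: "sparse_paving {..<10} 5 wheel_circuits"
proof
  have "\<forall>C\<in>wheel_circuits. C \<subseteq> {..<10} \<and> card C = 5"
    unfolding wheel_circuits_eq by code_simp
  then show "C \<subseteq> {..<10}" "card C = 5" if "C \<in> wheel_circuits" for C using that by auto
  have "\<forall>C\<in>wheel_circuits. \<forall>D\<in>wheel_circuits. C \<noteq> D \<longrightarrow> card (C \<inter> D) + 2 \<le> 5"
    unfolding wheel_circuits_eq by code_simp
  then show "card (C \<inter> D) + 2 \<le> 5" if "C \<in> wheel_circuits" "D \<in> wheel_circuits" "C \<noteq> D" for C D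
    using that by blast
qed simp_all

interpretation wheel: sparse_paving "{..<10}" 5 wheel_circuits
  by (rule sparse_paving_wheel)

text \<open>In a tight configuration of two equal triangles, \<open>C\<close> and \<open>F\<close> differ only inside \<open>B \<inter> D\<close>, which has
  at most one point, whereas neither is contained in the union of \<open>A\<close> with the other. For two
  different triangles, \<open>B \<inter> D = {}\<close> and the sets \<open>B, C, D, F\<close> are determined by the triangles. Then
  \<open>C \<union> F\<close> has six points, one more than the rank, and contains no circuit-hyperplane; so the
  nullity of \<open>A \<union> C \<union> F\<close> can be made up for only if \<open>A \<union> C\<close> and \<open>A \<union> F\<close> are both
  circuit-hyperplanes.\<close>

lemma wheel_not_tight:
  assumes sub: "A \<subseteq> {..<10}" "B \<subseteq> {..<10}" "C \<subseteq> {..<10}" "D \<subseteq> {..<10}" "F \<subseteq> {..<10}"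
  shows "\<not> wheel.tight_kinser_config A B C D F"
proof
  assume "wheel.tight_kinser_config A B C D F"
  then have circuits: "B \<union> D \<in> wheel_circuits" "B \<union> C \<in> wheel_circuits" "C \<union> D \<in> wheel_circuits"
      "B \<union> F \<in> wheel_circuits" "F \<union> D \<in> wheel_circuits"
    and triangles: "triangle (B \<union> D) (B \<union> C) (C \<union> D)" "triangle (B \<union> D) (B \<union> F) (F \<union> D)"
    and less: "wheel.r (A \<union> C) < wheel.r (A \<union> C \<union> F)" "wheel.r (A \<union> F) < wheel.r (A \<union> C \<union> F)"
    and excess: "int (card (A \<union> C \<union> F)) - int (wheel.r (A \<union> C \<union> F))
      = of_bool (A \<union> C \<in> wheel_circuits) + of_bool (A \<union> F \<in> wheel_circuits)"
    and AB: "A \<union> B \<notin> wheel_circuits"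
    and card: "card (B \<inter> D) = card (B \<inter> D - C) + card (B \<inter> D - F) + card (C \<inter> F - A) + card (A \<inter> B)"
    unfolding wheel.tight_kinser_config_def triangle_def by (simp_all, blast+)
  have fin: "finite A" "finite B" "finite C" "finite D" "finite F"
    using sub finite_subset by blast+
  let ?b = "(B \<union> D) \<inter> (B \<union> C) \<inter> (B \<union> F)" and ?d = "(B \<union> D) \<inter> (C \<union> D) \<inter> (F \<union> D)"
  have "B \<union> D \<subseteq> ?b \<union> ?d" by auto
  then consider
      (parallel) "B \<union> C = B \<union> F" "C \<union> D = F \<union> D" "card (?b \<inter> ?d) \<le> 1"
    | (path) C' T F' where "(C', T, F') \<in> rim_paths" "C' = (B \<union> C) \<inter> (C \<union> D)" "F' = (B \<union> F) \<inter> (F \<union> D)"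
        "?b = hub \<and> ?d = T \<or> ?b = T \<and> ?d = hub"
  proof -
    from wheel_triangle_pairs[OF circuits triangles \<open>B \<union> D \<subseteq> ?b \<union> ?d\<close>] show thesis
      by (elim disjE bexE conjE) (use that in auto)
  qed
  then show False
  proof cases
    case parallel
    have "A \<union> C \<union> F = A \<union> C" if "F \<subseteq> A \<union> C" using that by blast
    then have "\<not> F \<subseteq> A \<union> C" using less(1) by auto
    then obtain x where x: "x \<in> F" "x \<notin> A \<union> C" by blast
    have "A \<union> C \<union> F = A \<union> F" if "C \<subseteq> A \<union> F" using that by blast
    then have "\<not> C \<subseteq> A \<union> F" using less(2) by auto
    then obtain y where y: "y \<in> C" "y \<notin> A \<union> F" by blast
    have "x \<in> ?b \<inter> ?d" "y \<in> ?b \<inter> ?d" "x \<noteq> y" using x y parallel(1,2) by blast+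
    then have "card {x, y} \<le> card (?b \<inter> ?d)" using fin by (intro card_mono) auto
    then show False using \<open>x \<noteq> y\<close> parallel(3) by simp
  next
    case path
    note rims = wheel_rim_paths[OF path(1)]
    have disj: "?b \<inter> ?d = {}" using path(4) rims(2) by blast
    have BD: "?b = B" "?d = D" using disj by blast+
    have "B \<inter> D = {}" using disj by blast
    then have CF: "C = C'" "F = F'" unfolding path(2,3) by blast+
    have "card (C \<inter> F - A) = 0" "card (A \<inter> B) = 0" using card \<open>B \<inter> D = {}\<close> by simp_all
    then have "A \<inter> B = {}" using fin by simp
    have "card (C \<union> F) \<le> card (A \<union> C \<union> F)" using fin by (intro card_mono) auto
    then have ge6: "6 \<le> card (A \<union> C \<union> F)" using rims(4) CF by simp
    have le5: "wheel.r (A \<union> C \<union> F) \<le> 5" by (rule wheel.rank_le_k)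
    have some: "A \<union> C \<in> wheel_circuits \<or> A \<union> F \<in> wheel_circuits"
      using excess ge6 le5 by (auto simp: of_bool_def split: if_splits)
    then have r5: "wheel.r (A \<union> C \<union> F) = 5"
      using less le5 wheel.rank_circuit by fastforce
    have "\<not> A \<subseteq> C \<union> F" using some rims(5) CF by blast
    then have "C \<union> F \<subset> A \<union> C \<union> F" by auto
    then have "card (C \<union> F) < card (A \<union> C \<union> F)" using fin by (intro psubset_card_mono) auto
    then have "7 \<le> card (A \<union> C \<union> F)" using rims(4) CF by simp
    then have K: "A \<union> C \<in> wheel_circuits" "A \<union> F \<in> wheel_circuits" and card7: "card (A \<union> C \<union> F) = 7"
      using excess r5 by (auto simp: of_bool_def split: if_splits)
    have "(A \<union> C) \<union> (A \<union> F) = A \<union> C \<union> F" by auto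
    then have T: "(A \<union> C) \<inter> (A \<union> F) = T" "T \<subseteq> ((A \<union> C) - C) \<union> ((A \<union> F) - F)"
      using rims(6)[OF K] CF card7 by auto
    then have "A = T" by auto
    then have "B = hub" using path(4) \<open>A \<inter> B = {}\<close> rims(3) unfolding BD by blast
    then show False using AB \<open>A = T\<close> rims(1) by (simp add: Un_commute)
  qed
qed

lemma kinser_gap_wheel_nonneg:
  assumes "A \<subseteq> {..<10}" "B \<subseteq> {..<10}" "C \<subseteq> {..<10}" "D \<subseteq> {..<10}" "F \<subseteq> {..<10}"
  shows "0 \<le> kinser_gap wheel.r A B C D F"
  by (rule wheel.kinser_gap_nonneg[OF wheel_not_tight assms])

text \<open>The sets \<open>{2, 5, 6}\<close>, \<open>{1, 4, 5}\<close>, \<open>{0, 4, 7}\<close>, \<open>{3, 6, 7}\<close> are, in cyclic order, the rim triples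
  of the dual wheel. Its missing spoke \<open>{2, 5, 6, 8, 9}\<close> is the complement of \<open>rim 3 \<union> rim 0\<close>.\<close>

lemma kinser_gap_dual_wheel:
  "kinser_gap (sp_rank 5 ((-) {..<10} ` wheel_circuits)) {2, 5, 6} {8, 9} {1, 4, 5} {0, 4, 7} {3, 6, 7} = - 1"
  unfolding wheel_circuits_eq kinser_gap_def cond_info_def by code_simp

section \<open>Copies of the wheel in an infinite type\<close>

lemma sp_rank_image:
  assumes "inj f"
  shows "sp_rank k ((`) f ` \<C>) (f ` X) = sp_rank k \<C> X"
  using assms by (simp add: sp_rank_def card_image inj_on_subset[OF assms] inj_image_mem_iff inj_image_eq_iff image_iff)

lemma sparse_paving_image:
  assumes "sparse_paving E k \<C>" and f: "inj f"
  shows "sparse_paving (f ` E) k ((`) f ` \<C>)"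
proof -
  interpret sparse_paving E k \<C> by (rule assms(1))
  have card: "card (f ` X) = card X" for X by (rule card_image[OF inj_on_subset[OF f]]) simp
  show ?thesis
  proof
    show "card (C \<inter> D) + 2 \<le> k" if CD: "C \<in> (`) f ` \<C>" "D \<in> (`) f ` \<C>" "C \<noteq> D" for C D
    proof -
      obtain C' D' where "C' \<in> \<C>" "D' \<in> \<C>" "C = f ` C'" "D = f ` D'" using CD by blast
      moreover have "C \<inter> D = f ` (C' \<inter> D')" using calculation image_Int[OF f] by simp
      ultimately show ?thesis using CD(3) circuits_far_apart[of C' D'] card by auto
    qed
  qed (use finite_E k_pos k_less circuit_subset card_circuit in \<open>auto simp: card\<close>)
qed

lemma cond_info_image:
  assumes "\<And>X. s (f ` X) = r X"
  shows "cond_info s (f ` A) (f ` B) (f ` C) = cond_info r A B C"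
  by (simp add: cond_info_def assms flip: image_Un)

lemma kinser_gap_image:
  assumes "\<And>X. s (f ` X) = r X"
  shows "kinser_gap s (f ` A) (f ` B) (f ` C) (f ` D) (f ` F) = kinser_gap r A B C D F"
proof -
  have "cond_info s (f ` A) (f ` B) {} = cond_info r A B {}" for A B
    using cond_info_image[where s = s and f = f and r = r and C = "{}", OF assms] by simp
  then show ?thesis
    by (simp add: kinser_gap_def cond_info_image[where s = s and f = f and r = r, OF assms])
qed

theorem theorem4p6:
  "(kinser_class 5 :: ('a::infinite set \<times> 'a set set) set) \<noteq> dual_kinser_class 5 \<and>
   \<not> (\<forall>M \<in> (kinser_class 5 :: ('a set \<times> 'a set set) set). dual M \<in> kinser_class 5)"
proof -
  obtain f :: "nat \<Rightarrow> 'a" where f: "inj f"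
    using infinite_countable_subset[OF infinite_UNIV] by auto
  let ?E = "f ` {..<10}" and ?\<C> = "(`) f ` wheel_circuits"
  let ?\<D> = "(`) f ` (-) {..<10} ` wheel_circuits"
  let ?M = "(?E, sp_indep ?E 5 ?\<C>)"
  interpret M: sparse_paving ?E 5 ?\<C> by (rule sparse_paving_image[OF sparse_paving_wheel f])
  interpret N: sparse_paving ?E 5 ?\<D>
    using sparse_paving_image[OF wheel.dual_sparse_paving f] by simp
  have cardE: "card ?E = 10" using card_image[OF inj_on_subset[OF f], of "{..<10}"] by simp
  have "?\<D> = (-) ?E ` ?\<C>" by (simp add: image_image image_set_diff[OF f])
  then have dual: "dual ?M = (?E, sp_indep ?E 5 ?\<D>)"
    using M.dual_sp_indep cardE by simp
  have "0 \<le> kinser_gap M.r A B C D F"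
    if sub: "A \<subseteq> ?E" "B \<subseteq> ?E" "C \<subseteq> ?E" "D \<subseteq> ?E" "F \<subseteq> ?E" for A B C D F
  proof -
    obtain A' B' C' D' F' where "A' \<subseteq> {..<10}" "B' \<subseteq> {..<10}" "C' \<subseteq> {..<10}" "D' \<subseteq> {..<10}" "F' \<subseteq> {..<10}"
      and "A = f ` A'" "B = f ` B'" "C = f ` C'" "D = f ` D'" "F = f ` F'"
      using sub by (meson subset_image_iff)
    then show ?thesis
      using kinser_gap_wheel_nonneg kinser_gap_image[where s = M.r and f = f and r = wheel.r, OF sp_rank_image[OF f]] by simp
  qed
  then have M: "?M \<in> kinser_class 5" by (simp add: M.kinser_class_5_iff)
  have "kinser_gap N.r (f ` {2, 5, 6}) (f ` {8, 9}) (f ` {1, 4, 5}) (f ` {0, 4, 7}) (f ` {3, 6, 7}) < 0"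
    by (simp only: kinser_gap_image[where s = N.r and f = f, OF sp_rank_image[OF f]] kinser_gap_dual_wheel)
  moreover have "f ` {2, 5, 6} \<subseteq> ?E" "f ` {8, 9} \<subseteq> ?E" "f ` {1, 4, 5} \<subseteq> ?E" "f ` {0, 4, 7} \<subseteq> ?E"
    "f ` {3, 6, 7} \<subseteq> ?E" by (auto intro!: imageI)
  ultimately have N: "dual ?M \<notin> kinser_class 5"
    unfolding dual N.kinser_class_5_iff by (meson not_less)
  have "dual ?M \<in> dual_kinser_class 5" unfolding dual_kinser_class_def using M by (rule imageI)
  then show ?thesis using M N by metis
qed

end
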